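(* Let $(X,\mathscr{L},\lambda)$ and $(Y,\mathscr{M},\mu)$ be non-degenerate finite measure spaces, let $I \subseteq \mathbf{R}$ be a non-empty (necessarily open) interval, and let $f,g: I\to \mathbf{R}^+$ be continuous bijections. Then the equation $$ f^{-1}\!\left(\int_X f\!\left(g^{-1}\!\left(\int_Y g(h(x,y))\,d\mu(y)\right)\right)d\lambda(x)\right) = g^{-1}\!\left(\int_Y g\!\left(f^{-1}\!\left(\int_X f(h(x,y))\,d\lambda(x)\right)\right)d\mu(y)\right) $$ is satisfied by every $\mathscr{L}\otimes \mathscr{M}$-measurable simple function $h:X\times Y \to I$ if and only if there exists $c \in \mathbf{R}^+$ such that $f=c\,g$ (that is, $f(t)=c\,g(t)$ for all $t\in I$).
   Context: $\mathbf{R}^+$ denotes the set of (strictly) positive real numbers. A measure space $(S,\mathscr{C},\gamma)$ is called non-degenerate if there exists $A \in \mathscr{C}$ with $0 < \gamma(A) < \gamma(S)$. $\mathscr{L}\otimes\mathscr{M}$ denotes the product $\sigma$-algebra on $X\times Y$. An $\mathscr{L}\otimes \mathscr{M}$-measurable simple function $h: X\times Y\to I$ is a function of the form $h = \sum_{i=1}^n \alpha_i \mathbf{1}_{E_i}$, where $\alpha_1,\ldots,\alpha_n \in I$ and $E_1,\ldots,E_n \in \mathscr{L}\otimes \mathscr{M}$ are disjoint sets with $E_1\cup \cdots \cup E_n=X\times Y$. Under the stated hypotheses both sides of the equation are well defined for every such $h$. *)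

theory Defs
  imports "HOL-Analysis.Analysis"
begin

definition nondegenerate_measure :: "'a measure \<Rightarrow> bool" where
  "nondegenerate_measure M \<longleftrightarrow>
     (\<exists>A\<in>sets M. 0 < emeasure M A \<and> emeasure M A < emeasure M (space M))"

end

theory Submission
  imports Defs
begin

text \<open>
  Put \<open>\<phi> = f \<circ> g\<^sup>-\<^sup>1\<close>, a strictly monotone bijection of the positive reals, and \<open>\<psi> = \<phi>\<^sup>-\<^sup>1\<close>.
  If \<open>f = c g\<close>, then \<open>\<phi>\<close> is multiplication by \<open>c\<close> and the equation reduces to Fubini's
  theorem for the bounded function \<open>g \<circ> h\<close> (lemma \<open>proportional_imp_equation\<close>).

  Conversely, it is enough to know the equation for functions \<open>h\<close> that are constant on the four
  rectangles cut out by a set of intermediate measure in each factor. With \<open>a, a'\<close> and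
  \<open>b, b'\<close> the measures of the pieces and \<open>N(u, w) = \<psi> (a \<phi>(u) + a' \<phi>(w))\<close>, the equation says
  \<open>N (b p + b' q) = b N(p) + b' N(q)\<close> for all \<open>p, q\<close> in the open positive quadrant.
  The behaviour of \<open>N\<close> near the boundary of the quadrant decides everything.

  If \<open>\<phi>\<close> were decreasing, \<open>\<phi>(\<epsilon>)\<close> would tend to infinity as \<open>\<epsilon>\<close> tends to \<open>0\<close>, so that \<open>N\<close> would
  vanish on both axes. For \<open>p = (1, \<epsilon>)\<close> and \<open>q = (\<epsilon>, 1)\<close> the right-hand side would then tend to
  \<open>0\<close>, while the left-hand side stays above \<open>N(b, b') > 0\<close> (lemma \<open>not_decreasing\<close>).

  So \<open>\<phi>\<close> is increasing and extends continuously by \<open>\<phi>(0) = 0\<close>, and the equation extends to the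
  closed quadrant. There \<open>p\<close> and \<open>q\<close> may be taken on different axes. Applying \<open>\<phi>\<close> to
  \<open>N (b u, b' z) = b N(u, 0) + b' N(0, z)\<close>, and comparing with the cases \<open>z = 0\<close> and \<open>u = 0\<close>,
  shows that \<open>\<phi>\<close> of the sum on the right is the sum of its values at the two summands. Since these
  are arbitrary, \<open>\<phi>\<close> is additive (lemma \<open>additive_if_increasing\<close>), and a monotone
  additive function is linear.
\<close>

section \<open>Monotone additive functions and monotone bijections of the line\<close>

lemma monotone_additive_imp_linear:
  fixes \<phi> :: "real \<Rightarrow> real"
  assumes add: "\<And>s t. s > 0 \<Longrightarrow> t > 0 \<Longrightarrow> \<phi> (s + t) = \<phi> s + \<phi> t"
    and mono: "\<And>s t. 0 < s \<Longrightarrow> s < t \<Longrightarrow> \<phi> s < \<phi> t"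
    and t: "t > 0"
  shows "\<phi> t = \<phi> 1 * t"
proof (rule ccontr)
  have mult: "\<phi> (real (Suc n) * s) = real (Suc n) * \<phi> s" if "s > 0" for n s
  proof (induction n)
    case (Suc n)
    have "\<phi> (real (Suc n) * s + s) = \<phi> (real (Suc n) * s) + \<phi> s"
      using that by (intro add) auto
    then show ?case using Suc by (simp add: algebra_simps)
  qed simp
  define d where "d = \<bar>\<phi> t - \<phi> 1 * t\<bar>"
  assume "\<phi> t \<noteq> \<phi> 1 * t"
  then have "d > 0" by (simp add: d_def)
  \<comment> \<open>The error grows like \<open>n * d\<close> at \<open>n * t\<close>, but monotonicity between the two
      integers around \<open>n * t\<close> bounds it by \<open>\<phi> 1\<close>.\<close>
  then obtain n where n: "real n * d > \<bar>\<phi> 1\<bar>" "real n * t > 1"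
  proof -
    assume *: "\<And>n. \<bar>\<phi> 1\<bar> < real n * d \<Longrightarrow> 1 < real n * t \<Longrightarrow> thesis"
    obtain n1 n2 where n12: "real n1 * d > \<bar>\<phi> 1\<bar>" "real n2 * t > 1"
      using ex_less_of_nat_mult \<open>d > 0\<close> t by metis
    have "real n1 * d \<le> real (max n1 n2) * d" "real n2 * t \<le> real (max n1 n2) * t"
      using \<open>d > 0\<close> t by (auto intro!: mult_right_mono)
    with n12 show thesis by (intro *[of "max n1 n2"]) linarith+
  qed
  define k where "k = nat \<lfloor>real n * t\<rfloor>"
  have k: "real k \<le> real n * t" "real n * t < real k + 1" "k \<ge> 1" "n \<ge> 1"
    using n(2) by (auto simp: k_def le_nat_iff le_floor_iff Suc_le_eq intro: ccontr)
  have at_nat: "\<phi> (real j) = real j * \<phi> 1" if "j \<ge> 1" for j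
    using mult[of 1 "j - 1"] that by simp
  have nt: "\<phi> (real n * t) = real n * \<phi> t"
    using mult[of t "n - 1"] t k by simp
  have "real k * \<phi> 1 \<le> real n * \<phi> t"
    using mono[of "real k" "real n * t"] k at_nat[of k] nt by (cases "real k = real n * t") auto
  moreover have "real n * \<phi> t \<le> (real k + 1) * \<phi> 1"
    using mono[of "real n * t" "real (Suc k)"] k at_nat[of "Suc k"] nt n
    by (simp add: algebra_simps)
  moreover have "\<phi> 1 > 0"
    using mono[of 1 2] add[of 1 1] by simp
  then have "real k * \<phi> 1 \<le> real n * t * \<phi> 1" "real n * t * \<phi> 1 \<le> (real k + 1) * \<phi> 1"
    using k by (auto intro!: mult_right_mono)
  ultimately have "\<bar>real n * \<phi> t - real n * t * \<phi> 1\<bar> \<le> \<phi> 1"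
    by (simp add: algebra_simps abs_le_iff)
  moreover have "real n * d = \<bar>real n * \<phi> t - real n * t * \<phi> 1\<bar>"
  proof -
    have "real n * \<phi> t - real n * t * \<phi> 1 = real n * (\<phi> t - \<phi> 1 * t)"
      by (simp add: algebra_simps)
    then show ?thesis by (simp add: d_def abs_mult)
  qed
  ultimately show False using n by linarith
qed

text \<open>A monotone function can be discontinuous only by jumping, and a jump would leave a gap in
  the range.\<close>

lemma continuous_strict_mono_surj:
  fixes F :: "real \<Rightarrow> real"
  assumes "strict_mono F" "surj F"
  shows "isCont F x"
proof -
  have "continuous_on UNIV F"
    using assms by (intro continuous_onI_mono) (auto dest: strict_mono_mono monoD)
  then show ?thesis by (simp add: continuous_on_eq_continuous_at)
qed

section \<open>The equation for step functions with two values in each variable\<close>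

text \<open>Here \<open>u, v, w, z\<close> are the values of \<open>g \<circ> h\<close> on the four rectangles, \<open>u, v\<close> lying
  over the first piece of the first factor and \<open>u, w\<close> over the first piece of the second. Both
  sides have been mapped by \<open>f\<close>, so that only the conjugating function \<open>\<phi> = f \<circ> g\<^sup>-\<^sup>1\<close> and its
  inverse \<open>\<psi>\<close> remain.\<close>

locale two_by_two_equation =
  fixes \<phi> \<psi> :: "real \<Rightarrow> real" and a a' b b' :: real
  assumes weights: "a > 0" "a' > 0" "b > 0" "b' > 0"
    and pos: "\<And>s. s > 0 \<Longrightarrow> \<phi> s > 0" "\<And>s. s > 0 \<Longrightarrow> \<psi> s > 0"
    and inv: "\<And>s. s > 0 \<Longrightarrow> \<phi> (\<psi> s) = s" "\<And>s. s > 0 \<Longrightarrow> \<psi> (\<phi> s) = s"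
    and eq: "\<And>u v w z. u > 0 \<Longrightarrow> v > 0 \<Longrightarrow> w > 0 \<Longrightarrow> z > 0 \<Longrightarrow>
      a * \<phi> (b * u + b' * v) + a' * \<phi> (b * w + b' * z) =
      \<phi> (b * \<psi> (a * \<phi> u + a' * \<phi> w) + b' * \<psi> (a * \<phi> v + a' * \<phi> z))"
begin

text \<open>For decreasing \<open>\<phi>\<close> the quasi-arithmetic sum \<open>N\<close> is increasing in both arguments but small as
  soon as one argument is small, like a harmonic sum. The equation would make a sum of two such
  small values at least \<open>N b b'\<close>.\<close>

lemma not_decreasing:
  assumes dec: "\<And>s t. 0 < s \<Longrightarrow> s < t \<Longrightarrow> \<phi> t < \<phi> s"
  shows False
proof -
  have dec_le: "\<phi> t \<le> \<phi> s" if "0 < s" "s \<le> t" for s t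
    using dec[of s t] that by (cases "s = t") auto
  have \<psi>_le: "\<psi> t \<le> \<psi> s" if "0 < s" "s \<le> t" for s t
    using dec[of "\<psi> s" "\<psi> t"] that inv[of s] inv[of t] pos(2)[of s] by fastforce
  define N where "N u w = \<psi> (a * \<phi> u + a' * \<phi> w)" for u w
  have N_pos: "N u w > 0" if "u > 0" "w > 0" for u w
    unfolding N_def using that weights by (intro pos add_pos_pos mult_pos_pos)
  \<comment> \<open>\<open>\<epsilon>\<close> is so small that \<open>N 1 \<epsilon>\<close> and \<open>N \<epsilon> 1\<close> are at most \<open>r\<close>.\<close>
  define r where "r = N b b' / 2 / (b + b')"
  define \<epsilon> where "\<epsilon> = \<psi> (\<phi> r / min a a')"
  have r: "r > 0" unfolding r_def using N_pos weights by simp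
  have min: "min a a' > 0" using weights by simp
  have \<epsilon>: "\<epsilon> > 0" "\<phi> \<epsilon> = \<phi> r / min a a'"
    unfolding \<epsilon>_def using pos inv r min by auto
  have "min a a' * \<phi> \<epsilon> = \<phi> r" using \<epsilon> less_imp_neq[OF min] by simp
  then have large: "\<phi> r \<le> a * \<phi> \<epsilon>" "\<phi> r \<le> a' * \<phi> \<epsilon>"
    using mult_right_mono[of "min a a'" a "\<phi> \<epsilon>"] mult_right_mono[of "min a a'" a' "\<phi> \<epsilon>"]
      pos(1)[OF \<epsilon>(1)] by auto
  have one: "a * \<phi> 1 > 0" "a' * \<phi> 1 > 0" using pos weights by simp_all
  have "N 1 \<epsilon> \<le> \<psi> (\<phi> r)" "N \<epsilon> 1 \<le> \<psi> (\<phi> r)" unfolding N_def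
    using large one pos(1)[OF r] by (intro \<psi>_le; linarith)+
  then have small: "N 1 \<epsilon> \<le> r" "N \<epsilon> 1 \<le> r" using inv r by auto
  have S: "b * N 1 \<epsilon> + b' * N \<epsilon> 1 > 0" "b * 1 + b' * \<epsilon> > 0" "b * \<epsilon> + b' * 1 > 0"
    using N_pos \<epsilon> weights by (simp_all add: add_pos_pos)
  have eq': "N (b * 1 + b' * \<epsilon>) (b * \<epsilon> + b' * 1) = b * N 1 \<epsilon> + b' * N \<epsilon> 1"
    using eq[of 1 \<epsilon> \<epsilon> 1] \<epsilon> S inv(2) unfolding N_def by simp
  have "N b b' \<le> N (b * 1 + b' * \<epsilon>) (b * \<epsilon> + b' * 1)"
    unfolding N_def using weights \<epsilon> S(2,3)
    by (intro \<psi>_le add_mono mult_left_mono dec_le add_pos_pos mult_pos_pos pos) auto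
  also have "\<dots> \<le> b * r + b' * r"
    unfolding eq' using small weights by (intro add_mono mult_left_mono) auto
  also have "\<dots> = r * (b + b')" by (simp add: algebra_simps)
  also have "\<dots> = N b b' / 2"
    using nonzero_eq_divide_eq[of "b + b'" r "N b b' / 2"] weights by (simp add: r_def)
  finally show False using N_pos[of b b'] weights by simp
qed

text \<open>The positive quadrant is open, so the substitution of zeros on which the argument rests needs
  a passage to the limit. Extending \<open>\<phi>\<close> and \<open>\<psi>\<close> by the identity to the non-positive reals gives
  mutually inverse increasing bijections of the whole line, which are continuous for free.\<close>

lemma additive_if_increasing:
  assumes inc: "\<And>s t. 0 < s \<Longrightarrow> s < t \<Longrightarrow> \<phi> s < \<phi> t"
    and "p > 0" "q > 0"
  shows "\<phi> (p + q) = \<phi> p + \<phi> q"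
proof -
  define F where "F t = (if t > 0 then \<phi> t else t)" for t
  define G where "G t = (if t > 0 then \<psi> t else t)" for t
  have FG: "F (G t) = t" "G (F t) = t" for t
    using pos inv by (auto simp: F_def G_def)
  have F: "strict_mono F"
    unfolding strict_mono_def F_def using inc pos(1)
    by (auto intro: le_less_trans[OF leI])
  have G: "strict_mono G"
    using F FG unfolding strict_mono_def by (metis linorder_neqE_linordered_idom order_less_asym)
  have cont: "isCont F x" "isCont G x" for x
    using F G FG by (auto intro!: continuous_strict_mono_surj surjI)
  have F0: "F 0 = 0" "G 0 = 0" by (auto simp: F_def G_def)
  have nonneg: "F t \<ge> 0" "G t \<ge> 0" if "t \<ge> 0" for t
    using that pos by (auto simp: F_def G_def intro: less_imp_le)
  let ?l = "\<lambda>u v w z. a * F (b * u + b' * v) + a' * F (b * w + b' * z)"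
  let ?r = "\<lambda>u v w z. F (b * G (a * F u + a' * F w) + b' * G (a * F v + a' * F z))"
  have pos_case: "?l u v w z = ?r u v w z" if "u > 0" "v > 0" "w > 0" "z > 0" for u v w z
    using eq[OF that] that weights pos by (simp add: F_def G_def add_pos_pos)
  have closed: "?l u v w z = ?r u v w z" if "u \<ge> 0" "v \<ge> 0" "w \<ge> 0" "z \<ge> 0" for u v w z
  proof -
    let ?le = "\<lambda>e. ?l (u + e) (v + e) (w + e) (z + e)"
    let ?re = "\<lambda>e. ?r (u + e) (v + e) (w + e) (z + e)"
    have lim: "((\<lambda>e. t + e) \<longlongrightarrow> t + 0) (at_right 0)" for t :: real
      by (intro tendsto_intros)
    have "(?le \<longlongrightarrow> ?le 0) (at_right 0)" "(?re \<longlongrightarrow> ?re 0) (at_right 0)"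
      by (intro tendsto_add tendsto_mult tendsto_const lim isCont_tendsto_compose[OF cont(1)]
          isCont_tendsto_compose[OF cont(2)])+
    moreover have "eventually (\<lambda>e. ?le e = ?re e) (at_right 0)"
      unfolding eventually_at_right_field
      using that by (intro exI[of _ 1]) (auto intro!: pos_case add_nonneg_pos)
    ultimately have "?le 0 = ?re 0"
      using tendsto_cong[of ?le ?re] tendsto_unique[OF trivial_limit_at_right_real] by blast
    then show ?thesis by simp
  qed
  \<comment> \<open>These make the two terms inside \<open>F\<close> on the right-hand side equal to \<open>p\<close> and \<open>q\<close>.\<close>
  define u where "u = G (F (p / b) / a)"
  define z where "z = G (F (q / b') / a')"
  have uz: "u \<ge> 0" "z \<ge> 0"
    unfolding u_def z_def using assms weights by (auto intro!: nonneg divide_nonneg_pos)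
  have vals: "b * G (a * F u) = p" "b' * G (a' * F z) = q"
    unfolding u_def z_def using weights by (simp_all add: FG)
  have "a * F (b * u) + a' * F (b' * z) = F (p + q)"
    using closed[of u 0 0 z] uz F0 vals by simp
  moreover have "a * F (b * u) = F p"
    using closed[of u 0 0 0] uz F0 vals by simp
  moreover have "a' * F (b' * z) = F q"
    using closed[of 0 0 0 z] uz F0 vals by simp
  ultimately show ?thesis using assms by (simp add: F_def)
qed

end

section \<open>Finite measures\<close>

lemma (in finite_measure) integral_two_step:
  fixes p q :: real
  assumes "B \<in> sets M"
  shows "(\<integral>y. (if y \<in> B then p else q) \<partial>M) = measure M B * p + measure M (space M - B) * q"
proof -
  have "(\<integral>y. (if y \<in> B then p else q) \<partial>M) =
        (\<integral>y. indicator B y * p + indicator (space M - B) y * q \<partial>M)"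
    by (intro Bochner_Integration.integral_cong) (auto simp: indicator_def)
  also have "\<dots> = measure M B * p + measure M (space M - B) * q"
    using assms by (subst Bochner_Integration.integral_add) (auto simp: emeasure_eq_measure)
  finally show ?thesis .
qed

lemma nondegenerate_measure_split:
  assumes "finite_measure M" "nondegenerate_measure M"
  obtains B where "B \<in> sets M" "measure M B > 0" "measure M (space M - B) > 0"
proof -
  interpret finite_measure M by fact
  obtain B where B: "B \<in> sets M" "0 < emeasure M B" "emeasure M B < emeasure M (space M)"
    using assms unfolding nondegenerate_measure_def by auto
  then have "0 < measure M B" "measure M B < measure M (space M)"
    by (auto simp: emeasure_eq_measure ennreal_less_iff)
  then show thesis using B that by (auto simp: finite_measure_compl)
qed

lemma integral_lower_bound:
  fixes G :: "'a \<Rightarrow> real"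
  assumes "finite_measure M" "integrable M G" "\<And>x. x \<in> space M \<Longrightarrow> m \<le> G x"
  shows "m * measure M (space M) \<le> (\<integral>x. G x \<partial>M)"
proof -
  interpret finite_measure M by fact
  have "(\<integral>x. m \<partial>M) \<le> (\<integral>x. G x \<partial>M)"
    using assms by (intro integral_mono) auto
  then show ?thesis by (simp add: mult.commute)
qed

section \<open>The two directions\<close>

lemma strict_monotone_conjugate:
  fixes f g :: "real \<Rightarrow> real"
  assumes I: "is_interval I"
    and f: "continuous_on I f" "bij_betw f I {0<..}"
    and g: "continuous_on I g" "bij_betw g I {0<..}"
  defines "\<phi> \<equiv> \<lambda>s. f (inv_into I g s)"
  shows "(\<forall>s t. 0 < s \<and> s < t \<longrightarrow> \<phi> s < \<phi> t) \<or> (\<forall>s t. 0 < s \<and> s < t \<longrightarrow> \<phi> t < \<phi> s)"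
proof -
  have g': "inv_into I g s \<in> I" "g (inv_into I g s) = s" if "s > 0" for s
    using g(2) that by (auto simp: bij_betw_def inv_into_into f_inv_into_f)
  have mono_cases: "strict_mono_on I f \<or> strict_antimono_on I f"
      "strict_mono_on I g \<or> strict_antimono_on I g"
    using injective_eq_monotone_map[OF I f(1)] injective_eq_monotone_map[OF I g(1)] f g
    by (auto simp: bij_betw_def)
  have inv_mono: "inv_into I g s < inv_into I g t" if "strict_mono_on I g" "0 < s" "s < t" for s t
  proof (rule ccontr)
    assume "\<not> ?thesis"
    then have "g (inv_into I g t) \<le> g (inv_into I g s)"
      using that g' by (intro strict_mono_on_leD[OF that(1)]) auto
    then show False using that g'[of s] g'[of t] by simp
  qed
  have inv_antimono: "inv_into I g t < inv_into I g s"
    if "strict_antimono_on I g" "0 < s" "s < t" for s t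
  proof (rule ccontr)
    assume "\<not> ?thesis"
    then have "inv_into I g s < inv_into I g t \<or> inv_into I g s = inv_into I g t" by linarith
    then have "g (inv_into I g t) \<le> g (inv_into I g s)"
      using that g'[of s] g'[of t] monotone_onD[OF that(1)] by fastforce
    then show False using that g'[of s] g'[of t] by simp
  qed
  have g'_I: "inv_into I g s \<in> I" "inv_into I g t \<in> I" if "0 < s" "s < t" for s t
    using that g'(1) by auto
  have f_mono: "f x < f y" if "strict_mono_on I f" "x \<in> I" "y \<in> I" "x < y" for x y
    using monotone_onD[OF that] .
  have f_antimono: "f y < f x" if "strict_antimono_on I f" "x \<in> I" "y \<in> I" "x < y" for x y
    using monotone_onD[OF that] .
  from mono_cases show ?thesis
    unfolding \<phi>_def
    by (elim disjE) (blast intro: f_mono f_antimono g'_I inv_mono inv_antimono)+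
qed

text \<open>The function \<open>h\<close> in the proof takes the value \<open>g\<^sup>-\<^sup>1\<close> of \<open>u\<close>, \<open>v\<close>, \<open>w\<close>, \<open>z\<close> on the four
  rectangles; all inner integrals are then functions with two values.\<close>

lemma step_equation:
  fixes L :: "'a measure" and M :: "'b measure" and f g :: "real \<Rightarrow> real"
  assumes L: "finite_measure L" and M: "finite_measure M"
    and f: "bij_betw f I {0<..}" and g: "bij_betw g I {0<..}"
    and H: "\<And>h :: 'a \<times> 'b \<Rightarrow> real.
            simple_function (L \<Otimes>\<^sub>M M) h \<and> h \<in> space (L \<Otimes>\<^sub>M M) \<rightarrow> I \<Longrightarrow>
            inv_into I f (\<integral>x. f (inv_into I g (\<integral>y. g (h (x, y)) \<partial>M)) \<partial>L) =
            inv_into I g (\<integral>y. g (inv_into I f (\<integral>x. f (h (x, y)) \<partial>L)) \<partial>M)"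
    and A: "A \<in> sets L" "measure L A > 0" "measure L (space L - A) > 0"
    and B: "B \<in> sets M" "measure M B > 0" "measure M (space M - B) > 0"
  shows "two_by_two_equation (\<lambda>s. f (inv_into I g s)) (\<lambda>s. g (inv_into I f s))
     (measure L A) (measure L (space L - A)) (measure M B) (measure M (space M - B))"
proof -
  interpret L: finite_measure L by fact
  interpret M: finite_measure M by fact
  have f': "inv_into I f s \<in> I" "f (inv_into I f s) = s" if "s > 0" for s
    using f that by (auto simp: bij_betw_def inv_into_into f_inv_into_f)
  have g': "inv_into I g s \<in> I" "g (inv_into I g s) = s" if "s > 0" for s
    using g that by (auto simp: bij_betw_def inv_into_into f_inv_into_f)
  have fg_pos: "f x > 0" "g x > 0" "inv_into I f (f x) = x" "inv_into I g (g x) = x"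
    if "x \<in> I" for x
    using f g that by (auto simp: bij_betw_def)
  show ?thesis
  proof
    fix u v w z :: real
    assume uvwz: "u > 0" "v > 0" "w > 0" "z > 0"
    let ?\<phi> = "\<lambda>s. f (inv_into I g s)" and ?\<psi> = "\<lambda>s. g (inv_into I f s)"
    let ?a = "measure L A" and ?a' = "measure L (space L - A)"
      and ?b = "measure M B" and ?b' = "measure M (space M - B)"
    define h :: "'a \<times> 'b \<Rightarrow> real" where "h = (\<lambda>(x, y). inv_into I g
      (if x \<in> A then if y \<in> B then u else v else if y \<in> B then w else z))"
    have "simple_function (L \<Otimes>\<^sub>M M) h"
    proof -
      have "finite (range h)"
        by (rule finite_subset[of _ "inv_into I g ` {u, v, w, z}"]) (auto simp: h_def)
      then have "finite (h ` space (L \<Otimes>\<^sub>M M))"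
        by (rule finite_subset[rotated]) auto
      moreover have "h \<in> borel_measurable (L \<Otimes>\<^sub>M M)"
      proof -
        have "h = (\<lambda>p. if fst p \<in> A then if snd p \<in> B then inv_into I g u else inv_into I g v
            else if snd p \<in> B then inv_into I g w else inv_into I g z)"
          by (auto simp: h_def)
        also have "\<dots> \<in> borel_measurable (L \<Otimes>\<^sub>M M)"
          using A B by measurable
        finally show ?thesis .
      qed
      ultimately show ?thesis
        by (simp add: simple_function_borel_measurable)
    qed
    moreover have "h \<in> space (L \<Otimes>\<^sub>M M) \<rightarrow> I"
      using uvwz g' by (auto simp: h_def)
    ultimately have *: "inv_into I f (\<integral>x. f (inv_into I g (\<integral>y. g (h (x, y)) \<partial>M)) \<partial>L) =
            inv_into I g (\<integral>y. g (inv_into I f (\<integral>x. f (h (x, y)) \<partial>L)) \<partial>M)"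
      using H by blast
    have gh: "(\<integral>y. g (h (x, y)) \<partial>M) = (if x \<in> A then ?b * u + ?b' * v else ?b * w + ?b' * z)" for x
    proof -
      have "(\<lambda>y. g (h (x, y))) =
        (\<lambda>y. if y \<in> B then if x \<in> A then u else w else if x \<in> A then v else z)"
        using g' uvwz by (auto simp: h_def)
      then show ?thesis by (simp add: M.integral_two_step[OF B(1)])
    qed
    have fh: "(\<integral>x. f (h (x, y)) \<partial>L) =
        (if y \<in> B then ?a * ?\<phi> u + ?a' * ?\<phi> w else ?a * ?\<phi> v + ?a' * ?\<phi> z)" for y
    proof -
      have "(\<lambda>x. f (h (x, y))) =
        (\<lambda>x. if x \<in> A then if y \<in> B then ?\<phi> u else ?\<phi> v else if y \<in> B then ?\<phi> w else ?\<phi> z)"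
        by (auto simp: h_def)
      then show ?thesis by (simp add: L.integral_two_step[OF A(1)])
    qed
    have left: "(\<integral>x. f (inv_into I g (\<integral>y. g (h (x, y)) \<partial>M)) \<partial>L) =
        ?a * ?\<phi> (?b * u + ?b' * v) + ?a' * ?\<phi> (?b * w + ?b' * z)"
      unfolding gh by (simp add: L.integral_two_step[OF A(1)] if_distrib[of f] if_distrib[of "inv_into I g"])
    have right: "(\<integral>y. g (inv_into I f (\<integral>x. f (h (x, y)) \<partial>L)) \<partial>M) =
        ?b * ?\<psi> (?a * ?\<phi> u + ?a' * ?\<phi> w) + ?b' * ?\<psi> (?a * ?\<phi> v + ?a' * ?\<phi> z)"
      unfolding fh by (simp add: M.integral_two_step[OF B(1)] if_distrib[of g] if_distrib[of "inv_into I f"])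
    have "?a * ?\<phi> (?b * u + ?b' * v) + ?a' * ?\<phi> (?b * w + ?b' * z) > 0"
      using uvwz A B by (intro add_pos_pos mult_pos_pos fg_pos(1) g'(1))
    then show "?a * ?\<phi> (?b * u + ?b' * v) + ?a' * ?\<phi> (?b * w + ?b' * z) =
      ?\<phi> (?b * ?\<psi> (?a * ?\<phi> u + ?a' * ?\<phi> w) + ?b' * ?\<psi> (?a * ?\<phi> v + ?a' * ?\<phi> z))"
      using * f'(2) unfolding left right by metis
  qed (use A B f' g' fg_pos in auto)
qed

text \<open>Since \<open>f \<circ> g\<^sup>-\<^sup>1\<close> is multiplication by \<open>c\<close>, both sides are \<open>g\<^sup>-\<^sup>1\<close> of an iterated integral
  of \<open>g \<circ> h\<close>, in the two possible orders. The inverse functions are meaningful only at positive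
  arguments; the integrals are positive because \<open>g \<circ> h\<close> takes finitely many positive values and is
  therefore bounded away from \<open>0\<close>.\<close>

lemma proportional_imp_equation:
  fixes L :: "'a measure" and M :: "'b measure" and f g :: "real \<Rightarrow> real"
    and h :: "'a \<times> 'b \<Rightarrow> real"
  assumes L: "finite_measure L" "measure L (space L) > 0"
    and M: "finite_measure M" "measure M (space M) > 0"
    and f: "bij_betw f I {0<..}" and g: "bij_betw g I {0<..}"
    and c: "c > 0" "\<And>t. t \<in> I \<Longrightarrow> f t = c * g t"
    and h: "simple_function (L \<Otimes>\<^sub>M M) h" "h \<in> space (L \<Otimes>\<^sub>M M) \<rightarrow> I"
  shows "inv_into I f (\<integral>x. f (inv_into I g (\<integral>y. g (h (x, y)) \<partial>M)) \<partial>L) =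
         inv_into I g (\<integral>y. g (inv_into I f (\<integral>x. f (h (x, y)) \<partial>L)) \<partial>M)"
proof -
  interpret L: finite_measure L by fact
  interpret M: finite_measure M by fact
  interpret pair_sigma_finite L M ..
  interpret P: finite_measure "L \<Otimes>\<^sub>M M"
    by (rule finite_measure_pair_measure[OF M(1) L(1)])
  have f': "inv_into I f s \<in> I" "f (inv_into I f s) = s" if "s > 0" for s
    using f that by (auto simp: bij_betw_def inv_into_into f_inv_into_f)
  have g': "inv_into I g s \<in> I" "g (inv_into I g s) = s" if "s > 0" for s
    using g that by (auto simp: bij_betw_def inv_into_into f_inv_into_f)
  have g_pos: "g x > 0" if "x \<in> I" for x
    using g that by (auto simp: bij_betw_def)
  have \<phi>: "f (inv_into I g s) = c * s" if "s > 0" for s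
    using c g' that by simp
  have \<psi>: "g (inv_into I f s) = s / c" if "s > 0" for s
    using c f'[OF that] by (metis nonzero_mult_div_cancel_left less_irrefl)
  have inv_eq: "inv_into I f (c * s) = inv_into I g s" if "s > 0" for s
    using \<phi>[OF that] g'(1)[OF that] f by (metis bij_betw_def inv_into_f_f)
  define G where "G = (\<lambda>p. g (h p))"
  \<comment> \<open>The element \<open>1\<close> only keeps \<open>S\<close> non-empty, so that its extrema exist.\<close>
  define S where "S = insert 1 (G ` space (L \<Otimes>\<^sub>M M))"
  have Gs: "simple_function (L \<Otimes>\<^sub>M M) G"
    unfolding G_def using simple_function_compose1[OF h(1)] .
  have S: "finite S" "S \<noteq> {}" "\<And>s. s \<in> S \<Longrightarrow> s > 0"
    using simple_functionD(1)[OF Gs] h(2) g_pos by (auto simp: S_def G_def)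
  define m where "m = Min S"
  have m: "m > 0" unfolding m_def using S by simp
  have G_lower: "m \<le> G (x, y)" if "x \<in> space L" "y \<in> space M" for x y
    unfolding m_def using S that by (intro Min_le) (auto simp: S_def space_pair_measure)
  have G_upper: "G p \<le> Max S" if "p \<in> space (L \<Otimes>\<^sub>M M)" for p
    using S that by (intro Max_ge) (auto simp: S_def)
  have Gm: "G \<in> borel_measurable (L \<Otimes>\<^sub>M M)"
    using Gs by (rule borel_measurable_simple_function)
  have bd: "\<bar>G p\<bar> \<le> Max S" if "p \<in> space (L \<Otimes>\<^sub>M M)" for p
    using G_upper[OF that] that G_lower[of "fst p" "snd p"] m by (auto simp: space_pair_measure)
  have int: "integrable (L \<Otimes>\<^sub>M M) G"
    using Gm bd by (intro P.integrable_const_bound[of _ "Max S"]) auto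
  have int_y: "integrable M (\<lambda>y. G (x, y))" if "x \<in> space L" for x
    using that Gm bd
    by (intro M.integrable_const_bound[of _ "Max S"]) (auto simp: space_pair_measure)
  have int_x: "integrable L (\<lambda>x. G (x, y))" if "y \<in> space M" for y
    using that Gm bd
    by (intro L.integrable_const_bound[of _ "Max S"]) (auto simp: space_pair_measure)
  have lower_y: "(\<integral>y. G (x, y) \<partial>M) \<ge> m * measure M (space M)" if "x \<in> space L" for x
    using that by (intro integral_lower_bound[OF M(1) int_y G_lower])
  have lower_x: "(\<integral>x. G (x, y) \<partial>L) \<ge> m * measure L (space L)" if "y \<in> space M" for y
    using that by (intro integral_lower_bound[OF L(1) int_x G_lower])
  have pos_y: "(\<integral>y. G (x, y) \<partial>M) > 0" if "x \<in> space L" for x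
    using lower_y[OF that] m M by (meson less_le_trans mult_pos_pos)
  have pos_x: "(\<integral>x. G (x, y) \<partial>L) > 0" if "y \<in> space M" for y
    using lower_x[OF that] m L by (meson less_le_trans mult_pos_pos)
  have "(\<integral>x. (\<integral>y. G (x, y) \<partial>M) \<partial>L) \<ge> m * measure M (space M) * measure L (space L)"
    by (rule integral_lower_bound[OF L(1) integrable_fst'[OF int] lower_y])
  then have pos: "(\<integral>x. (\<integral>y. G (x, y) \<partial>M) \<partial>L) > 0"
    using m L M by (meson less_le_trans mult_pos_pos)
  have "(\<integral>x. f (inv_into I g (\<integral>y. g (h (x, y)) \<partial>M)) \<partial>L) = (\<integral>x. c * (\<integral>y. G (x, y) \<partial>M) \<partial>L)"
    using pos_y \<phi> by (intro Bochner_Integration.integral_cong) (auto simp: G_def)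
  also have "\<dots> = c * (\<integral>x. (\<integral>y. G (x, y) \<partial>M) \<partial>L)" by simp
  finally have left: "inv_into I f (\<integral>x. f (inv_into I g (\<integral>y. g (h (x, y)) \<partial>M)) \<partial>L) =
      inv_into I g (\<integral>x. (\<integral>y. G (x, y) \<partial>M) \<partial>L)"
    using inv_eq[OF pos] by simp
  have "(\<integral>y. g (inv_into I f (\<integral>x. f (h (x, y)) \<partial>L)) \<partial>M) = (\<integral>y. (\<integral>x. G (x, y) \<partial>L) \<partial>M)"
  proof (intro Bochner_Integration.integral_cong refl)
    fix y assume y: "y \<in> space M"
    have "(\<integral>x. f (h (x, y)) \<partial>L) = (\<integral>x. c * G (x, y) \<partial>L)"
      using y h(2) c(2) by (intro Bochner_Integration.integral_cong) (auto simp: G_def space_pair_measure)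
    then show "g (inv_into I f (\<integral>x. f (h (x, y)) \<partial>L)) = (\<integral>x. G (x, y) \<partial>L)"
      using \<psi>[of "c * (\<integral>x. G (x, y) \<partial>L)"] pos_x[OF y] c(1) by simp
  qed
  also have "\<dots> = (\<integral>x. (\<integral>y. G (x, y) \<partial>M) \<partial>L)"
    using Fubini_integral[of "\<lambda>x y. G (x, y)"] int by simp
  finally show ?thesis using left by simp
qed

theorem theorem2:
  fixes L :: "'a measure" and M :: "'b measure"
    and I :: "real set" and f g :: "real \<Rightarrow> real"
  assumes "finite_measure L" and "nondegenerate_measure L"
    and "finite_measure M" and "nondegenerate_measure M"
    and "is_interval I" and "I \<noteq> {}"
    and "continuous_on I f" and "bij_betw f I {0<..}"
    and "continuous_on I g" and "bij_betw g I {0<..}"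
  shows "(\<forall>h :: 'a \<times> 'b \<Rightarrow> real.
            simple_function (L \<Otimes>\<^sub>M M) h \<and> h \<in> space (L \<Otimes>\<^sub>M M) \<rightarrow> I \<longrightarrow>
            inv_into I f (\<integral>x. f (inv_into I g (\<integral>y. g (h (x, y)) \<partial>M)) \<partial>L) =
            inv_into I g (\<integral>y. g (inv_into I f (\<integral>x. f (h (x, y)) \<partial>L)) \<partial>M))
         \<longleftrightarrow> (\<exists>c>0. \<forall>t\<in>I. f t = c * g t)"
    (is "?equation \<longleftrightarrow> _")
proof -
  obtain A where A: "A \<in> sets L" "measure L A > 0" "measure L (space L - A) > 0"
    using nondegenerate_measure_split assms(1,2) by blast
  obtain B where B: "B \<in> sets M" "measure M B > 0" "measure M (space M - B) > 0"
    using nondegenerate_measure_split assms(3,4) by blast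
  show ?thesis
  proof
    assume ?equation
    define \<phi> where "\<phi> = (\<lambda>s. f (inv_into I g s))"
    interpret two_by_two_equation \<phi> "\<lambda>s. g (inv_into I f s)"
      "measure L A" "measure L (space L - A)" "measure M B" "measure M (space M - B)"
      unfolding \<phi>_def
      by (rule step_equation) (use assms A B \<open>?equation\<close> in auto)
    have inc: "\<phi> s < \<phi> t" if "0 < s" "s < t" for s t
      using strict_monotone_conjugate[OF assms(5,7-10)] not_decreasing that
      unfolding \<phi>_def by blast
    have lin: "\<phi> s = \<phi> 1 * s" if "s > 0" for s
      using monotone_additive_imp_linear[of \<phi> s] additive_if_increasing inc that by blast
    have "f t = \<phi> 1 * g t" if "t \<in> I" for t
    proof -
      have "g t > 0" "inv_into I g (g t) = t"
        using assms(10) that by (auto simp: bij_betw_def)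
      then show ?thesis using lin[of "g t"] by (simp add: \<phi>_def)
    qed
    then show "\<exists>c>0. \<forall>t\<in>I. f t = c * g t"
      using pos(1)[of 1] by auto
  next
    assume "\<exists>c>0. \<forall>t\<in>I. f t = c * g t"
    then obtain c where c: "c > 0" "\<And>t. t \<in> I \<Longrightarrow> f t = c * g t" by auto
    interpret L: finite_measure L by fact
    interpret M: finite_measure M by fact
    have "measure L (space L) > 0" "measure M (space M) > 0"
      using A(2) B(2) L.bounded_measure[of A] M.bounded_measure[of B] by linarith+
    then show ?equation
      using assms c by (blast intro: proportional_imp_equation)
  qed
qed

end
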